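(* Let $A$ be a definite quaternion algebra over $\mathbb{Q}$ (i.e. ramified at $\infty$) that is ramified at the finite prime $r$. For every positive integer $m$, $m$ is an outlier for $A$ if and only if $m r^2$ is an outlier for $A$.
   Context: An element of $A$ is an integer if its monic minimal polynomial over $\mathbb{Q}$ has coefficients in $\mathbb{Z}$. A positive integer $m$ is an outlier for $A$ if $m$ is the reduced norm of some element of $A$ but not the reduced norm of any integer of $A$ (for definite $A$ over $\mathbb{Q}$ every positive rational is a reduced norm of some element). *)

theory Defs
  imports
    Complex_Main
    "HOL-Computational_Algebra.Computational_Algebra"
    "HOL-Algebra.Module"
    "HOL-Algebra.Algebraic_Closure_Type"
begin

section \<open>Associative algebras over a field\<close>

text \<open>The locale \<^locale>\<open>algebra\<close> of the library only covers commutative algebras.\<close>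

definition assoc_algebra ::
  "('k, 'c) ring_scheme \<Rightarrow> ('k, 'a, 'm) module_scheme \<Rightarrow> bool" where
  "assoc_algebra K A \<longleftrightarrow>
     field K \<and> module K A \<and> ring A \<and>
     (\<forall>c\<in>carrier K. \<forall>x\<in>carrier A. \<forall>y\<in>carrier A.
        (c \<odot>\<^bsub>A\<^esub> x) \<otimes>\<^bsub>A\<^esub> y = c \<odot>\<^bsub>A\<^esub> (x \<otimes>\<^bsub>A\<^esub> y) \<and>
        x \<otimes>\<^bsub>A\<^esub> (c \<odot>\<^bsub>A\<^esub> y) = c \<odot>\<^bsub>A\<^esub> (x \<otimes>\<^bsub>A\<^esub> y))"

definition algebra_iso ::
  "('k, 'c) ring_scheme \<Rightarrow> ('k, 'a, 'm) module_scheme \<Rightarrow> ('k, 'b, 'n) module_scheme \<Rightarrow> ('a \<Rightarrow> 'b) set"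
  where
  "algebra_iso K A B =
     {h \<in> ring_iso A B.
        \<forall>c\<in>carrier K. \<forall>x\<in>carrier A. h (c \<odot>\<^bsub>A\<^esub> x) = c \<odot>\<^bsub>B\<^esub> h x}"

definition skew_field :: "('a, 'm) ring_scheme \<Rightarrow> bool" where
  "skew_field R \<longleftrightarrow> ring R \<and> Units R = carrier R - {\<zero>\<^bsub>R\<^esub>}"


section \<open>Quaternion algebras\<close>

text \<open>
  The algebra $(a,b)_K$: the tuple \<open>(t, x, y, z)\<close> stands for $t + x i + y j + z k$, where
  $i^2 = a$, $j^2 = b$ and $k = i j = - j i$ (hence $k^2 = - a b$).
\<close>

definition hilbert_algebra ::
  "('k, 'c) ring_scheme \<Rightarrow> 'k \<Rightarrow> 'k \<Rightarrow> ('k, 'k \<times> 'k \<times> 'k \<times> 'k) module" where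
  "hilbert_algebra K a b =
     \<lparr>carrier = carrier K \<times> carrier K \<times> carrier K \<times> carrier K,
      monoid.mult = (\<lambda>(t, x, y, z) (t', x', y', z').
        (t \<otimes>\<^bsub>K\<^esub> t' \<oplus>\<^bsub>K\<^esub> a \<otimes>\<^bsub>K\<^esub> (x \<otimes>\<^bsub>K\<^esub> x') \<oplus>\<^bsub>K\<^esub> b \<otimes>\<^bsub>K\<^esub> (y \<otimes>\<^bsub>K\<^esub> y')
           \<ominus>\<^bsub>K\<^esub> a \<otimes>\<^bsub>K\<^esub> b \<otimes>\<^bsub>K\<^esub> (z \<otimes>\<^bsub>K\<^esub> z'),
         t \<otimes>\<^bsub>K\<^esub> x' \<oplus>\<^bsub>K\<^esub> x \<otimes>\<^bsub>K\<^esub> t' \<oplus>\<^bsub>K\<^esub> b \<otimes>\<^bsub>K\<^esub> (z \<otimes>\<^bsub>K\<^esub> y') \<ominus>\<^bsub>K\<^esub> b \<otimes>\<^bsub>K\<^esub> (y \<otimes>\<^bsub>K\<^esub> z'),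
         t \<otimes>\<^bsub>K\<^esub> y' \<oplus>\<^bsub>K\<^esub> y \<otimes>\<^bsub>K\<^esub> t' \<oplus>\<^bsub>K\<^esub> a \<otimes>\<^bsub>K\<^esub> (x \<otimes>\<^bsub>K\<^esub> z') \<ominus>\<^bsub>K\<^esub> a \<otimes>\<^bsub>K\<^esub> (z \<otimes>\<^bsub>K\<^esub> x'),
         t \<otimes>\<^bsub>K\<^esub> z' \<oplus>\<^bsub>K\<^esub> z \<otimes>\<^bsub>K\<^esub> t' \<oplus>\<^bsub>K\<^esub> x \<otimes>\<^bsub>K\<^esub> y' \<ominus>\<^bsub>K\<^esub> y \<otimes>\<^bsub>K\<^esub> x')),
      one = (\<one>\<^bsub>K\<^esub>, \<zero>\<^bsub>K\<^esub>, \<zero>\<^bsub>K\<^esub>, \<zero>\<^bsub>K\<^esub>),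
      zero = (\<zero>\<^bsub>K\<^esub>, \<zero>\<^bsub>K\<^esub>, \<zero>\<^bsub>K\<^esub>, \<zero>\<^bsub>K\<^esub>),
      add = (\<lambda>(t, x, y, z) (t', x', y', z').
        (t \<oplus>\<^bsub>K\<^esub> t', x \<oplus>\<^bsub>K\<^esub> x', y \<oplus>\<^bsub>K\<^esub> y', z \<oplus>\<^bsub>K\<^esub> z')),
      module.smult = (\<lambda>c (t, x, y, z). (c \<otimes>\<^bsub>K\<^esub> t, c \<otimes>\<^bsub>K\<^esub> x, c \<otimes>\<^bsub>K\<^esub> y, c \<otimes>\<^bsub>K\<^esub> z))\<rparr>"

abbreviation rat_field :: "rat ring" where
  "rat_field \<equiv> ring_of_type_algebra"

abbreviation real_field :: "real ring" where
  "real_field \<equiv> ring_of_type_algebra"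

definition has_hilbert_symbol :: "(rat, 'a, 'm) module_scheme \<Rightarrow> rat \<Rightarrow> rat \<Rightarrow> bool" where
  "has_hilbert_symbol A a b \<longleftrightarrow>
     a \<noteq> 0 \<and> b \<noteq> 0 \<and> algebra_iso rat_field (hilbert_algebra rat_field a b) A \<noteq> {}"

definition rat_quaternion_algebra :: "(rat, 'a, 'm) module_scheme \<Rightarrow> bool" where
  "rat_quaternion_algebra A \<longleftrightarrow>
     assoc_algebra rat_field A \<and> (\<exists>a b. has_hilbert_symbol A a b)"

text \<open>
  The standard involution is the unique one as below; the reduced norm is $x \bar x$,
  viewed in the ground field.
\<close>

definition standard_involution :: "(rat, 'a, 'm) module_scheme \<Rightarrow> ('a \<Rightarrow> 'a) \<Rightarrow> bool" where
  "standard_involution A s \<longleftrightarrow>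
     s \<in> carrier A \<rightarrow> carrier A \<and>
     (\<forall>x\<in>carrier A. \<forall>y\<in>carrier A. s (x \<oplus>\<^bsub>A\<^esub> y) = s x \<oplus>\<^bsub>A\<^esub> s y) \<and>
     (\<forall>c. \<forall>x\<in>carrier A. s (c \<odot>\<^bsub>A\<^esub> x) = c \<odot>\<^bsub>A\<^esub> s x) \<and>
     s \<one>\<^bsub>A\<^esub> = \<one>\<^bsub>A\<^esub> \<and>
     (\<forall>x\<in>carrier A. s (s x) = x) \<and>
     (\<forall>x\<in>carrier A. \<forall>y\<in>carrier A. s (x \<otimes>\<^bsub>A\<^esub> y) = s y \<otimes>\<^bsub>A\<^esub> s x) \<and>
     (\<forall>x\<in>carrier A. \<exists>c. x \<otimes>\<^bsub>A\<^esub> s x = c \<odot>\<^bsub>A\<^esub> \<one>\<^bsub>A\<^esub>)"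

definition reduced_norm :: "(rat, 'a, 'm) module_scheme \<Rightarrow> 'a \<Rightarrow> rat" where
  "reduced_norm A x =
     (THE c. \<exists>s. standard_involution A s \<and> x \<otimes>\<^bsub>A\<^esub> s x = c \<odot>\<^bsub>A\<^esub> \<one>\<^bsub>A\<^esub>)"


section \<open>The field of $p$-adic numbers\<close>

definition padic_abs :: "nat \<Rightarrow> rat \<Rightarrow> real" where
  "padic_abs p q =
     (if q = 0 then 0
      else real p powi
        (int (multiplicity (int p) (snd (quotient_of q)))
         - int (multiplicity (int p) (fst (quotient_of q)))))"

definition padic_cauchy_ring :: "nat \<Rightarrow> (nat \<Rightarrow> rat) ring" where
  "padic_cauchy_ring p =
     \<lparr>carrier = {s. \<forall>e>0. \<exists>N. \<forall>m\<ge>N. \<forall>n\<ge>N. padic_abs p (s m - s n) < e},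
      monoid.mult = (\<lambda>s t n. s n * t n), one = (\<lambda>n. 1),
      zero = (\<lambda>n. 0), add = (\<lambda>s t n. s n + t n)\<rparr>"

definition padic_null_ideal :: "nat \<Rightarrow> (nat \<Rightarrow> rat) set" where
  "padic_null_ideal p = {s. (\<lambda>n. padic_abs p (s n)) \<longlonglongrightarrow> 0}"

definition padic_field :: "nat \<Rightarrow> (nat \<Rightarrow> rat) set ring" where
  "padic_field p = padic_cauchy_ring p Quot padic_null_ideal p"

definition padic_of_rat :: "nat \<Rightarrow> rat \<Rightarrow> (nat \<Rightarrow> rat) set" where
  "padic_of_rat p q = padic_null_ideal p +>\<^bsub>padic_cauchy_ring p\<^esub> (\<lambda>n. q)"


section \<open>Ramification\<close>

text \<open>
  For an embedding \<open>f\<close> of the rationals into a field \<open>K\<close>, if \<open>A\<close> is isomorphic to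
  $(a,b)_{\mathbf Q}$ then its scalar extension $A \otimes_{\mathbf Q} K$ is
  $(f(a), f(b))_K$; up to isomorphism the latter does not depend on the choice of \<open>a\<close>, \<open>b\<close>.
\<close>

definition ramified_in ::
  "('k, 'c) ring_scheme \<Rightarrow> (rat \<Rightarrow> 'k) \<Rightarrow> (rat, 'a, 'm) module_scheme \<Rightarrow> bool" where
  "ramified_in K f A \<longleftrightarrow>
     (\<exists>a b. has_hilbert_symbol A a b \<and> skew_field (hilbert_algebra K (f a) (f b)))"

definition ramified_at_prime :: "nat \<Rightarrow> (rat, 'a, 'm) module_scheme \<Rightarrow> bool" where
  "ramified_at_prime p A \<longleftrightarrow> ramified_in (padic_field p) (padic_of_rat p) A"

definition definite :: "(rat, 'a, 'm) module_scheme \<Rightarrow> bool" where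
  "definite A \<longleftrightarrow> ramified_in real_field of_rat A"


section \<open>Integers and outliers\<close>

definition algebra_poly :: "(rat, 'a, 'm) module_scheme \<Rightarrow> rat poly \<Rightarrow> 'a \<Rightarrow> 'a" where
  "algebra_poly A p x =
     (\<Oplus>\<^bsub>A\<^esub>i\<in>{..degree p}. coeff p i \<odot>\<^bsub>A\<^esub> (x [^]\<^bsub>A\<^esub> i))"

definition is_min_poly :: "(rat, 'a, 'm) module_scheme \<Rightarrow> 'a \<Rightarrow> rat poly \<Rightarrow> bool" where
  "is_min_poly A x p \<longleftrightarrow>
     lead_coeff p = 1 \<and> algebra_poly A p x = \<zero>\<^bsub>A\<^esub> \<and>
     (\<forall>q. q \<noteq> 0 \<and> algebra_poly A q x = \<zero>\<^bsub>A\<^esub> \<longrightarrow> degree p \<le> degree q)"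

definition is_integer :: "(rat, 'a, 'm) module_scheme \<Rightarrow> 'a \<Rightarrow> bool" where
  "is_integer A x \<longleftrightarrow>
     x \<in> carrier A \<and> (\<exists>p. is_min_poly A x p \<and> (\<forall>i. coeff p i \<in> \<int>))"

definition outlier :: "(rat, 'a, 'm) module_scheme \<Rightarrow> nat \<Rightarrow> bool" where
  "outlier A m \<longleftrightarrow>
     m > 0 \<and>
     (\<exists>x\<in>carrier A. reduced_norm A x = of_nat m) \<and>
     \<not> (\<exists>x. is_integer A x \<and> reduced_norm A x = of_nat m)"

end

theory Submission
  imports Defs
begin

text \<open>
  Multiplication by \<open>r\<close> turns integers of norm $m$ into integers of norm $m r^2$. Conversely, let
  $x$ be an integer of norm $m r^2$ and put $v = x / r$, which has norm $m$ and trace $k / r$ for an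
  integer $k$. If $r$ did not divide $k$, then $X^2 - (k/r) X + m$ would have a root $\alpha$ in
  $\mathbf{Q}_r$ by Hensel's lemma, and $(v - \alpha)(\bar v - \alpha) = 0$ would exhibit zero divisors
  in the completion at $r$, which is a division algebra. Hence $v$ is an integer of norm $m$.
\<close>

section \<open>The $p$-adic absolute value and the $p$-adic field\<close>

text \<open>Hensel's lemma applies because the trace k/r then has r-adic absolute value r > 1, while
  that of the norm m is at most 1. So the Newton polygon of X^2 - (k/r) X + m has two different
  slopes. Rescaling X by the trace gives Y^2 - Y + c with |c| < 1; at Y = 0 the derivative 2Y - 1 is
  a unit for every prime, so r = 2 needs no separate treatment. The root is obtained by iterating y
  -> c + y^2 from 0, a contraction by the factor |c|. It is kept as a Cauchy sequence of rationals,
  and the zero-divisor identity is checked on representatives modulo null sequences. One obstacle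
  remains: for rational v the factors may vanish, and there the bound on the trace comes from the
  norm being the square of v.\<close>

lemma padic_abs_zero [simp]: "padic_abs p 0 = 0"
  by (simp add: padic_abs_def)

lemma padic_abs_nonneg [simp]: "0 \<le> padic_abs p q"
  by (simp add: padic_abs_def)

definition padic_cauchy :: "nat \<Rightarrow> (nat \<Rightarrow> rat) \<Rightarrow> bool" where
  "padic_cauchy p s \<longleftrightarrow> (\<forall>e>0. \<exists>N. \<forall>m\<ge>N. \<forall>n\<ge>N. padic_abs p (s m - s n) < e)"

text \<open>Epsilon form of membership in \<open>padic_null_ideal\<close>, so that null and Cauchy
  sequences are treated by the same kind of estimate.\<close>

definition padic_null :: "nat \<Rightarrow> (nat \<Rightarrow> rat) \<Rightarrow> bool" where
  "padic_null p s \<longleftrightarrow> (\<forall>e>0. \<exists>N. \<forall>n\<ge>N. padic_abs p (s n) < e)"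

text \<open>Extends \<open>padic_of_rat\<close> from constant sequences to arbitrary ones, since the
  root is available only through its approximations.\<close>

definition padic_class :: "nat \<Rightarrow> (nat \<Rightarrow> rat) \<Rightarrow> (nat \<Rightarrow> rat) set" where
  "padic_class p s = padic_null_ideal p +>\<^bsub>padic_cauchy_ring p\<^esub> s"

context
  fixes p :: nat
  assumes prime_p: "Factorial_Ring.prime p"
begin

lemma prime_elem_int_p: "prime_elem (int p)"
  using prime_p by (simp add: prime_imp_prime_elem)

text \<open>Frees the absolute value from lowest terms: cross-multiplying with the reduced fraction
  and using additivity of the multiplicity of a prime shows that cancelled factors do not
  matter.\<close>

lemma padic_abs_fraction:
  assumes "x \<noteq> 0" "y \<noteq> 0"
  shows "padic_abs p (of_int x / of_int y)
    = real p powi (int (multiplicity (int p) y) - int (multiplicity (int p) x))"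
proof -
  define q :: rat where "q = of_int x / of_int y"
  obtain n d where nd: "quotient_of q = (n, d)" by fastforce
  have "d > 0" using quotient_of_denom_pos[OF nd] .
  have "q \<noteq> 0" using assms by (simp add: q_def)
  have q: "q = of_int n / of_int d" using quotient_of_div[OF nd] .
  with \<open>q \<noteq> 0\<close> have "n \<noteq> 0" by auto
  have "of_int (x * d) = (of_int (n * y) :: rat)"
    using q assms \<open>d > 0\<close> by (simp add: q_def field_simps)
  then have "x * d = n * y" by (simp only: of_int_eq_iff)
  then have "multiplicity (int p) (x * d) = multiplicity (int p) (n * y)" by simp
  then have "multiplicity (int p) x + multiplicity (int p) d
      = multiplicity (int p) n + multiplicity (int p) y"
    using assms \<open>d > 0\<close> \<open>n \<noteq> 0\<close>
    by (simp add: prime_elem_multiplicity_mult_distrib[OF prime_elem_int_p])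
  then have "int (multiplicity (int p) d) - int (multiplicity (int p) n)
      = int (multiplicity (int p) y) - int (multiplicity (int p) x)" by linarith
  then show ?thesis using \<open>q \<noteq> 0\<close> nd by (simp add: padic_abs_def flip: q_def)
qed

lemma rat_fraction_cases:
  obtains x y :: int where "y \<noteq> 0" "(q::rat) = of_int x / of_int y"
proof -
  obtain x y where xy: "quotient_of q = (x, y)" by fastforce
  then show ?thesis
    using that[of y x] quotient_of_div[OF xy] quotient_of_denom_pos[OF xy] by simp
qed

lemma padic_abs_mult: "padic_abs p (u * v) = padic_abs p u * padic_abs p v"
proof (cases "u = 0 \<or> v = 0")
  case False
  obtain x y where u: "y \<noteq> 0" "u = of_int x / of_int y" by (rule rat_fraction_cases)
  obtain z w where v: "w \<noteq> 0" "v = of_int z / of_int w" by (rule rat_fraction_cases)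
  have nz: "x \<noteq> 0" "z \<noteq> 0" using False u v by auto
  have uv: "u * v = of_int (x * z) / of_int (y * w)" using u v by simp
  have p0: "real p \<noteq> 0" using prime_p by auto
  have "padic_abs p (u * v) = real p powi
     ((int (multiplicity (int p) y) - int (multiplicity (int p) x))
      + (int (multiplicity (int p) w) - int (multiplicity (int p) z)))"
    unfolding uv using u v nz
    by (subst padic_abs_fraction)
      (auto simp: prime_elem_multiplicity_mult_distrib[OF prime_elem_int_p] algebra_simps)
  also have "\<dots> = padic_abs p u * padic_abs p v"
    using u v nz p0 by (simp add: padic_abs_fraction power_int_add)
  finally show ?thesis .
qed auto

text \<open>Over a common denominator, the smaller of the two powers of \<open>p\<close> divides
  both numerators and hence their sum. Zero values are split off because multiplicities describe
  only nonzero numerators.\<close>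

lemma padic_abs_add_le: "padic_abs p (u + v) \<le> max (padic_abs p u) (padic_abs p v)"
proof (cases "u = 0 \<or> v = 0 \<or> u + v = 0")
  case False
  obtain x y where u: "y \<noteq> 0" "u = of_int x / of_int y" by (rule rat_fraction_cases)
  obtain z w where v: "w \<noteq> 0" "v = of_int z / of_int w" by (rule rat_fraction_cases)
  define a b d where "a = x * w" and "b = z * y" and "d = y * w"
  have ad: "d \<noteq> 0" "u = of_int a / of_int d" "v = of_int b / of_int d"
    using u v by (auto simp: a_def b_def d_def)
  have s: "u + v = of_int (a + b) / of_int d" using ad by (simp add: add_divide_distrib)
  have nz: "a \<noteq> 0" "b \<noteq> 0" "a + b \<noteq> 0" using False ad s by auto
  let ?m = "multiplicity (int p)"
  have "min (?m a) (?m b) \<le> ?m (a + b)"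
  proof (rule multiplicity_geI)
    show "int p ^ min (?m a) (?m b) dvd a + b"
      by (intro dvd_add multiplicity_dvd') simp_all
  qed (use nz prime_elem_int_p in \<open>auto simp: prime_elem_def\<close>)
  then have "int (?m d) - int (?m (a + b)) \<le> int (?m d) - int (?m a)
      \<or> int (?m d) - int (?m (a + b)) \<le> int (?m d) - int (?m b)" by linarith
  then have "real p powi (int (?m d) - int (?m (a + b))) \<le> real p powi (int (?m d) - int (?m a))
      \<or> real p powi (int (?m d) - int (?m (a + b))) \<le> real p powi (int (?m d) - int (?m b))"
    using prime_ge_1_nat[OF prime_p] power_int_increasing[of _ _ "real p"] by auto
  then show ?thesis
    unfolding s unfolding ad(2,3) le_max_iff_disj
    by (simp only: padic_abs_fraction[OF nz(1) ad(1)] padic_abs_fraction[OF nz(2) ad(1)]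
        padic_abs_fraction[OF nz(3) ad(1)])
qed (auto simp: le_max_iff_disj)

lemma padic_abs_one [simp]: "padic_abs p 1 = 1"
  using padic_abs_fraction[of 1 1] by simp

lemma padic_abs_minus [simp]: "padic_abs p (- u) = padic_abs p u"
proof -
  have "padic_abs p (- 1) = 1"
    using padic_abs_fraction[of "- 1" 1] by (simp add: multiplicity_unit_right)
  then show ?thesis using padic_abs_mult[of "- 1" u] by simp
qed

lemma padic_abs_minus_commute: "padic_abs p (u - v) = padic_abs p (v - u)"
  using padic_abs_minus[of "u - v"] by simp

lemma padic_abs_diff_le: "padic_abs p (u - v) \<le> max (padic_abs p u) (padic_abs p v)"
  using padic_abs_add_le[of u "- v"] by simp

lemma padic_abs_pos_iff: "0 < padic_abs p u \<longleftrightarrow> u \<noteq> 0"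
  using prime_p by (auto simp: padic_abs_def prime_gt_0_nat)

lemma padic_abs_power: "padic_abs p (u ^ n) = padic_abs p u ^ n"
  by (induction n) (auto simp: padic_abs_mult)

lemma padic_abs_of_int_le_1: "padic_abs p (of_int k) \<le> 1"
proof (cases "k = 0")
  case False
  have "real p powi (- int (multiplicity (int p) k)) \<le> real p powi 0"
    using prime_p prime_ge_1_nat by (intro power_int_increasing) auto
  then show ?thesis using padic_abs_fraction[of k 1] False by simp
qed auto

lemma padic_abs_unit: "\<not> int p dvd k \<Longrightarrow> padic_abs p (of_int k) = 1"
  using padic_abs_fraction[of k 1]
  by (cases "k = 0") (auto simp: not_dvd_imp_multiplicity_0)

lemma padic_abs_p: "padic_abs p (of_nat p) = 1 / real p"
  using padic_abs_fraction[of "int p" 1] prime_p prime_elem_int_p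
  by (auto simp: power_int_minus field_simps)

section \<open>Cauchy and null sequences of rationals\<close>

lemma padic_null_ideal_eq: "padic_null_ideal p = Collect (padic_null p)"
  by (auto simp: padic_null_ideal_def padic_null_def LIMSEQ_iff)

lemma padic_cauchy_const: "padic_cauchy p (\<lambda>n. c)"
  by (auto simp: padic_cauchy_def)

lemma padic_cauchy_uminus: "padic_cauchy p s \<Longrightarrow> padic_cauchy p (\<lambda>n. - s n)"
  unfolding padic_cauchy_def using padic_abs_minus_commute by simp

lemma padic_cauchy_add:
  assumes "padic_cauchy p s" "padic_cauchy p t"
  shows "padic_cauchy p (\<lambda>n. s n + t n)"
  unfolding padic_cauchy_def
proof (intro allI impI)
  fix e :: real assume "e > 0"
  obtain N where N: "\<And>m n. m \<ge> N \<Longrightarrow> n \<ge> N \<Longrightarrow> padic_abs p (s m - s n) < e"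
    using assms(1) \<open>e > 0\<close> unfolding padic_cauchy_def by meson
  obtain M where M: "\<And>m n. m \<ge> M \<Longrightarrow> n \<ge> M \<Longrightarrow> padic_abs p (t m - t n) < e"
    using assms(2) \<open>e > 0\<close> unfolding padic_cauchy_def by meson
  have "padic_abs p (s m + t m - (s n + t n)) < e" if "m \<ge> max N M" "n \<ge> max N M" for m n
    using N[of m n] M[of m n] padic_abs_add_le[of "s m - s n" "t m - t n"] that
    by (simp add: algebra_simps)
  then show "\<exists>N. \<forall>m\<ge>N. \<forall>n\<ge>N. padic_abs p (s m + t m - (s n + t n)) < e" by blast
qed

text \<open>Tolerance 1 and the ultrametric inequality bound a tail; a tail is enough for the
  estimates of products. The maximum with 1 keeps \<open>B\<close> positive, so that it can be
  divided by.\<close>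

lemma padic_cauchy_bounded:
  assumes "padic_cauchy p s"
  obtains B N where "B > 0" "\<And>n. n \<ge> N \<Longrightarrow> padic_abs p (s n) \<le> B"
proof -
  obtain N where N: "\<And>m n. m \<ge> N \<Longrightarrow> n \<ge> N \<Longrightarrow> padic_abs p (s m - s n) < 1"
    using assms unfolding padic_cauchy_def by (metis zero_less_one)
  have "padic_abs p (s n) \<le> max 1 (padic_abs p (s N))" if "n \<ge> N" for n
    using padic_abs_add_le[of "s n - s N" "s N"] N[of n N] that by auto
  then show ?thesis by (intro that[of "max 1 (padic_abs p (s N))" N]) auto
qed

lemma padic_null_imp_cauchy:
  assumes "padic_null p s"
  shows "padic_cauchy p s"
  unfolding padic_cauchy_def
proof (intro allI impI)
  fix e :: real assume "e > 0"
  obtain N where N: "\<And>n. n \<ge> N \<Longrightarrow> padic_abs p (s n) < e"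
    using assms \<open>e > 0\<close> unfolding padic_null_def by meson
  have "padic_abs p (s m - s n) < e" if "m \<ge> N" "n \<ge> N" for m n
    using N[of m] N[of n] that padic_abs_diff_le[of "s m" "s n"] by simp
  then show "\<exists>N. \<forall>m\<ge>N. \<forall>n\<ge>N. padic_abs p (s m - s n) < e" by blast
qed

lemma padic_null_add:
  assumes "padic_null p s" "padic_null p t"
  shows "padic_null p (\<lambda>n. s n + t n)"
  unfolding padic_null_def
proof (intro allI impI)
  fix e :: real assume "e > 0"
  obtain N where N: "\<And>n. n \<ge> N \<Longrightarrow> padic_abs p (s n) < e"
    using assms(1) \<open>e > 0\<close> unfolding padic_null_def by meson
  obtain M where M: "\<And>n. n \<ge> M \<Longrightarrow> padic_abs p (t n) < e"
    using assms(2) \<open>e > 0\<close> unfolding padic_null_def by meson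
  have "padic_abs p (s n + t n) < e" if "n \<ge> max N M" for n
    using N[of n] M[of n] that padic_abs_add_le[of "s n" "t n"] by simp
  then show "\<exists>N. \<forall>n\<ge>N. padic_abs p (s n + t n) < e" by blast
qed

lemma padic_null_uminus: "padic_null p s \<Longrightarrow> padic_null p (\<lambda>n. - s n)"
  by (simp add: padic_null_def)

lemma padic_null_mult:
  assumes "padic_null p s" "padic_cauchy p t"
  shows "padic_null p (\<lambda>n. s n * t n)"
  unfolding padic_null_def
proof (intro allI impI)
  fix e :: real assume "e > 0"
  obtain B M where B: "B > 0" "\<And>n. n \<ge> M \<Longrightarrow> padic_abs p (t n) \<le> B"
    using padic_cauchy_bounded[OF assms(2)] by blast
  obtain N where N: "\<And>n. n \<ge> N \<Longrightarrow> padic_abs p (s n) < e / B"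
    using assms(1) \<open>e > 0\<close> \<open>B > 0\<close> unfolding padic_null_def by (meson divide_pos_pos)
  have "padic_abs p (s n * t n) < e" if "n \<ge> max N M" for n
  proof -
    have "padic_abs p (s n) * padic_abs p (t n) \<le> padic_abs p (s n) * B"
      using B that by (intro mult_left_mono) auto
    also have "\<dots> < e" using N[of n] that \<open>B > 0\<close> by (simp add: field_simps)
    finally show ?thesis by (simp add: padic_abs_mult)
  qed
  then show "\<exists>N. \<forall>n\<ge>N. padic_abs p (s n * t n) < e" by blast
qed

lemma padic_cauchy_mult:
  assumes "padic_cauchy p s" "padic_cauchy p t"
  shows "padic_cauchy p (\<lambda>n. s n * t n)"
  unfolding padic_cauchy_def
proof (intro allI impI)
  fix e :: real assume "e > 0"
  obtain B M where B: "B > 0" "\<And>n. n \<ge> M \<Longrightarrow> padic_abs p (s n) \<le> B"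
    using padic_cauchy_bounded[OF assms(1)] by blast
  obtain C K where C: "C > 0" "\<And>n. n \<ge> K \<Longrightarrow> padic_abs p (t n) \<le> C"
    using padic_cauchy_bounded[OF assms(2)] by blast
  obtain N where N: "\<And>m n. m \<ge> N \<Longrightarrow> n \<ge> N \<Longrightarrow> padic_abs p (s m - s n) < e / C"
    using assms(1) \<open>e > 0\<close> \<open>C > 0\<close> unfolding padic_cauchy_def by (meson divide_pos_pos)
  obtain L where L: "\<And>m n. m \<ge> L \<Longrightarrow> n \<ge> L \<Longrightarrow> padic_abs p (t m - t n) < e / B"
    using assms(2) \<open>e > 0\<close> \<open>B > 0\<close> unfolding padic_cauchy_def by (meson divide_pos_pos)
  let ?N = "max (max N L) (max M K)"
  have "padic_abs p (s m * t m - s n * t n) < e" if "m \<ge> ?N" "n \<ge> ?N" for m n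
  proof -
    have "padic_abs p (s m) * padic_abs p (t m - t n) \<le> B * padic_abs p (t m - t n)"
      using B that by (intro mult_right_mono) auto
    also have "\<dots> < e" using L[of m n] that \<open>B > 0\<close> by (simp add: field_simps)
    finally have 1: "padic_abs p (s m * (t m - t n)) < e" by (simp add: padic_abs_mult)
    have "padic_abs p (s m - s n) * padic_abs p (t n) \<le> padic_abs p (s m - s n) * C"
      using C that by (intro mult_left_mono) auto
    also have "\<dots> < e" using N[of m n] that \<open>C > 0\<close> by (simp add: field_simps)
    finally have 2: "padic_abs p ((s m - s n) * t n) < e" by (simp add: padic_abs_mult)
    have "s m * t m - s n * t n = s m * (t m - t n) + (s m - s n) * t n"
      by (simp add: algebra_simps)
    then show ?thesis using 1 2 padic_abs_add_le[of "s m * (t m - t n)" "(s m - s n) * t n"] by simp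
  qed
  then show "\<exists>N. \<forall>m\<ge>N. \<forall>n\<ge>N. padic_abs p (s m * t m - s n * t n) < e" by blast
qed

section \<open>The ring of Cauchy sequences and its quotient field\<close>

lemma padic_cauchy_ring_simps:
  "carrier (padic_cauchy_ring p) = Collect (padic_cauchy p)"
  "s \<otimes>\<^bsub>padic_cauchy_ring p\<^esub> t = (\<lambda>n. s n * t n)"
  "s \<oplus>\<^bsub>padic_cauchy_ring p\<^esub> t = (\<lambda>n. s n + t n)"
  "\<one>\<^bsub>padic_cauchy_ring p\<^esub> = (\<lambda>n. 1)"
  "\<zero>\<^bsub>padic_cauchy_ring p\<^esub> = (\<lambda>n. 0)"
  by (auto simp: padic_cauchy_ring_def padic_cauchy_def)

lemma cring_padic_cauchy_ring: "cring (padic_cauchy_ring p)"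
proof (intro cringI abelian_groupI comm_monoidI; unfold padic_cauchy_ring_simps mem_Collect_eq)
  fix s assume "padic_cauchy p s"
  then show "\<exists>y\<in>Collect (padic_cauchy p). (\<lambda>n. y n + s n) = (\<lambda>n. 0)"
    by (intro bexI[of _ "\<lambda>n. - s n"]) (auto intro: padic_cauchy_uminus)
qed (simp_all add: padic_cauchy_add padic_cauchy_mult padic_cauchy_const mult_ac add_ac ring_distribs)

lemma padic_cauchy_ring_uminus:
  assumes "padic_cauchy p s"
  shows "\<ominus>\<^bsub>padic_cauchy_ring p\<^esub> s = (\<lambda>n. - s n)"
proof -
  interpret cring "padic_cauchy_ring p" by (rule cring_padic_cauchy_ring)
  show ?thesis
    using assms padic_cauchy_uminus[OF assms]
    by (intro minus_equality) (auto simp: padic_cauchy_ring_simps)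
qed

lemma ideal_padic_null_ideal: "ideal (padic_null_ideal p) (padic_cauchy_ring p)"
proof -
  interpret cring "padic_cauchy_ring p" by (rule cring_padic_cauchy_ring)
  show ?thesis
  proof (rule idealI)
    show "subgroup (padic_null_ideal p) (add_monoid (padic_cauchy_ring p))"
    proof (rule add.subgroupI)
      show "padic_null_ideal p \<noteq> {}"
        unfolding padic_null_ideal_eq by (auto intro!: exI[of _ "\<lambda>n. 0"] simp: padic_null_def)
      show "\<ominus>\<^bsub>padic_cauchy_ring p\<^esub> s \<in> padic_null_ideal p" if "s \<in> padic_null_ideal p" for s
        using that unfolding padic_null_ideal_eq
        by (simp add: padic_cauchy_ring_uminus padic_null_imp_cauchy padic_null_uminus)
    qed (auto simp: padic_null_ideal_eq padic_cauchy_ring_simps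
        intro: padic_null_imp_cauchy padic_null_add)
    fix s t assume st: "s \<in> padic_null_ideal p" "t \<in> carrier (padic_cauchy_ring p)"
    then show *: "s \<otimes>\<^bsub>padic_cauchy_ring p\<^esub> t \<in> padic_null_ideal p"
      by (simp add: padic_null_ideal_eq padic_cauchy_ring_simps padic_null_mult)
    then show "t \<otimes>\<^bsub>padic_cauchy_ring p\<^esub> s \<in> padic_null_ideal p"
      by (simp add: padic_cauchy_ring_simps mult.commute)
  qed (rule ring_axioms)
qed

lemma ring_hom_padic_class: "padic_class p \<in> ring_hom (padic_cauchy_ring p) (padic_field p)"
  using ideal.rcos_ring_hom[OF ideal_padic_null_ideal]
  by (simp add: padic_field_def padic_class_def[abs_def])

lemma ring_hom_cring_padic_class:
  "ring_hom_cring (padic_cauchy_ring p) (padic_field p) (padic_class p)"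
  using ideal.rcos_ring_hom_cring[OF ideal_padic_null_ideal cring_padic_cauchy_ring]
  by (simp add: padic_field_def padic_class_def[abs_def])

lemma padic_class_closed: "padic_cauchy p s \<Longrightarrow> padic_class p s \<in> carrier (padic_field p)"
  using ring_hom_closed[OF ring_hom_padic_class, of s]
  by (simp add: padic_cauchy_ring_simps)

lemma padic_class_mult:
  "padic_cauchy p s \<Longrightarrow> padic_cauchy p t \<Longrightarrow>
    padic_class p s \<otimes>\<^bsub>padic_field p\<^esub> padic_class p t = padic_class p (\<lambda>n. s n * t n)"
  using ring_hom_mult[OF ring_hom_padic_class, of s t]
  by (simp add: padic_cauchy_ring_simps)

lemma padic_class_add:
  "padic_cauchy p s \<Longrightarrow> padic_cauchy p t \<Longrightarrow>
    padic_class p s \<oplus>\<^bsub>padic_field p\<^esub> padic_class p t = padic_class p (\<lambda>n. s n + t n)"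
  using ring_hom_add[OF ring_hom_padic_class, of s t]
  by (simp add: padic_cauchy_ring_simps)

lemma padic_class_diff:
  assumes "padic_cauchy p s" "padic_cauchy p t"
  shows "padic_class p s \<ominus>\<^bsub>padic_field p\<^esub> padic_class p t = padic_class p (\<lambda>n. s n - t n)"
proof -
  interpret ring_hom_cring "padic_cauchy_ring p" "padic_field p" "padic_class p"
    by (rule ring_hom_cring_padic_class)
  have "\<ominus>\<^bsub>padic_field p\<^esub> padic_class p t = padic_class p (\<lambda>n. - t n)"
    using hom_a_inv[of t] assms(2)
    by (simp add: padic_cauchy_ring_simps padic_cauchy_ring_uminus)
  then show ?thesis
    using padic_class_add[OF assms(1) padic_cauchy_uminus[OF assms(2)]]
    by (simp add: a_minus_def)
qed

text \<open>The zero coset is the ideal itself. One direction later shows that a product vanishes,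
  the other that coordinates of a vanishing factor are zero.\<close>

lemma padic_class_eq_zero_iff:
  assumes "padic_cauchy p s"
  shows "padic_class p s = \<zero>\<^bsub>padic_field p\<^esub> \<longleftrightarrow> padic_null p s"
proof -
  interpret ideal "padic_null_ideal p" "padic_cauchy_ring p" by (rule ideal_padic_null_ideal)
  have "\<zero>\<^bsub>padic_field p\<^esub> = padic_null_ideal p" by (simp add: padic_field_def FactRing_def)
  then show ?thesis
    using assms rcos_const_imp_mem[of s] a_rcos_zero[OF ideal_axioms, of s]
    by (auto simp: padic_class_def padic_cauchy_ring_simps padic_null_ideal_eq)
qed

text \<open>A nonzero constant has a fixed positive absolute value, which defeats the tolerance
  equal to it. This is the injectivity of the map from the rationals to the p-adic numbers.\<close>

lemma padic_null_const_iff: "padic_null p (\<lambda>n. c) \<longleftrightarrow> c = 0"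
  unfolding padic_null_def by (metis less_irrefl padic_abs_pos_iff padic_abs_zero order_refl)

end

section \<open>Integrality of traces in a $p$-adic division algebra\<close>

text \<open>For small \<open>c\<close> this converges \<open>p\<close>-adically to the small root of $X^2 - X + c$.\<close>

primrec quadratic_root_approx :: "rat \<Rightarrow> nat \<Rightarrow> rat" where
  "quadratic_root_approx c 0 = 0"
| "quadratic_root_approx c (Suc n) = c + (quadratic_root_approx c n)\<^sup>2"

context
  fixes p :: nat and c :: rat
  assumes prime_p: "Factorial_Ring.prime p"
    and c_lt_1: "padic_abs p c < 1"
begin

text \<open>The ball of radius |c| is stable under y -> c + y^2, because |c|^2 <= |c|.\<close>

lemma quadratic_root_approx_le: "padic_abs p (quadratic_root_approx c n) \<le> padic_abs p c"
proof (induction n)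
  case (Suc n)
  have "padic_abs p ((quadratic_root_approx c n)\<^sup>2) \<le> padic_abs p c ^ 2"
    using Suc by (simp add: padic_abs_power[OF prime_p] power_mono)
  also have "\<dots> \<le> padic_abs p c"
    using c_lt_1 by (simp add: power2_eq_square mult_left_le)
  finally show ?case
    using padic_abs_add_le[OF prime_p, of c "(quadratic_root_approx c n)\<^sup>2"] by simp
qed simp

text \<open>A difference of squares factors, and by the previous bound the sum factor has size at
  most |c|; each step therefore shrinks by |c|.\<close>

lemma quadratic_root_approx_step:
  "padic_abs p (quadratic_root_approx c (Suc n) - quadratic_root_approx c n) \<le> padic_abs p c ^ Suc n"
proof (induction n)
  case (Suc n)
  let ?y = "quadratic_root_approx c"
  have "?y (Suc (Suc n)) - ?y (Suc n) = (?y (Suc n) - ?y n) * (?y (Suc n) + ?y n)"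
    by (simp add: power2_eq_square algebra_simps)
  then have "padic_abs p (?y (Suc (Suc n)) - ?y (Suc n))
      = padic_abs p (?y (Suc n) - ?y n) * padic_abs p (?y (Suc n) + ?y n)"
    by (simp only: padic_abs_mult[OF prime_p])
  also have "\<dots> \<le> padic_abs p c ^ Suc n * padic_abs p c"
  proof (rule mult_mono[OF Suc])
    show "padic_abs p (?y (Suc n) + ?y n) \<le> padic_abs p c"
      using padic_abs_add_le[OF prime_p, of "?y (Suc n)" "?y n"]
        quadratic_root_approx_le[of "Suc n"] quadratic_root_approx_le[of n] by linarith
  qed simp_all
  finally show ?case by (simp add: mult.commute)
qed simp

text \<open>By the ultrametric inequality a sum of steps is no larger than its largest term, so no
  geometric series has to be summed.\<close>

lemma quadratic_root_approx_diff:
  "padic_abs p (quadratic_root_approx c (n + k) - quadratic_root_approx c n) \<le> padic_abs p c ^ n"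
proof (induction k)
  case (Suc k)
  let ?y = "quadratic_root_approx c"
  have "padic_abs p (?y (Suc (n + k)) - ?y (n + k)) \<le> padic_abs p c ^ Suc (n + k)"
    by (rule quadratic_root_approx_step)
  also have "\<dots> \<le> padic_abs p c ^ n"
    using c_lt_1 by (intro power_decreasing) auto
  finally have "padic_abs p ((?y (Suc (n + k)) - ?y (n + k)) + (?y (n + k) - ?y n)) \<le> padic_abs p c ^ n"
    using Suc padic_abs_add_le[OF prime_p, of "?y (Suc (n + k)) - ?y (n + k)" "?y (n + k) - ?y n"]
    by linarith
  then show ?case by (simp add: algebra_simps)
qed simp

lemma quadratic_root_approx_cauchy: "padic_cauchy p (quadratic_root_approx c)"
  unfolding padic_cauchy_def
proof (intro allI impI)
  fix e :: real assume "e > 0"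
  let ?y = "quadratic_root_approx c"
  obtain N where N: "padic_abs p c ^ N < e"
    using real_arch_pow_inv[OF \<open>e > 0\<close> c_lt_1] by blast
  have "padic_abs p (?y m - ?y n) < e" if "m \<ge> N" "n \<ge> N" for m n
  proof -
    have *: "padic_abs p (?y k - ?y N) < e" if "k \<ge> N" for k
      using quadratic_root_approx_diff[of N "k - N"] that N by simp
    show ?thesis
      using *[OF that(1)] *[OF that(2)] padic_abs_diff_le[OF prime_p, of "?y m - ?y N" "?y n - ?y N"]
      by simp
  qed
  then show "\<exists>N. \<forall>m\<ge>N. \<forall>n\<ge>N. padic_abs p (?y m - ?y n) < e" by blast
qed

text \<open>The value of Y^2 - Y + c at an approximation is exactly the next step of the iteration,
  so the step bound is already the bound on the residue.\<close>

lemma quadratic_root_approx_null: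
  "padic_null p (\<lambda>n. (quadratic_root_approx c n)\<^sup>2 - quadratic_root_approx c n + c)"
  unfolding padic_null_def
proof (intro allI impI)
  fix e :: real assume "e > 0"
  let ?y = "quadratic_root_approx c"
  obtain N where N: "padic_abs p c ^ N < e"
    using real_arch_pow_inv[OF \<open>e > 0\<close> c_lt_1] by blast
  have "padic_abs p ((?y n)\<^sup>2 - ?y n + c) < e" if "n \<ge> N" for n
  proof -
    have "padic_abs p ((?y n)\<^sup>2 - ?y n + c) \<le> padic_abs p c ^ Suc n"
      using quadratic_root_approx_step[of n] by (simp add: algebra_simps)
    also have "\<dots> \<le> padic_abs p c ^ N" using c_lt_1 that by (intro power_decreasing) auto
    finally show ?thesis using N by simp
  qed
  then show "\<exists>N. \<forall>n\<ge>N. padic_abs p ((?y n)\<^sup>2 - ?y n + c) < e" by blast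
qed

end

lemma skew_field_no_zero_divisors:
  assumes "skew_field R" "x \<in> carrier R" "y \<in> carrier R" "x \<otimes>\<^bsub>R\<^esub> y = \<zero>\<^bsub>R\<^esub>"
  shows "x = \<zero>\<^bsub>R\<^esub> \<or> y = \<zero>\<^bsub>R\<^esub>"
proof (rule disjCI)
  interpret ring R using assms(1) by (simp add: skew_field_def)
  assume "y \<noteq> \<zero>\<^bsub>R\<^esub>"
  then have "y \<in> Units R" using assms by (simp add: skew_field_def)
  then obtain u where "u \<in> carrier R" "y \<otimes>\<^bsub>R\<^esub> u = \<one>\<^bsub>R\<^esub>" by (auto simp: Units_def)
  then have "x = (x \<otimes>\<^bsub>R\<^esub> y) \<otimes>\<^bsub>R\<^esub> u" using assms(2,3) by (simp add: m_assoc)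
  then show "x = \<zero>\<^bsub>R\<^esub>" using assms \<open>u \<in> carrier R\<close> by simp
qed

text \<open>The product of t + x i + y j + z k with its conjugate; the last sign comes from k^2 =
  -ab. It is identified with \<open>reduced_norm\<close> in \<open>reduced_norm_h\<close>.\<close>

definition quaternion_norm :: "rat \<Rightarrow> rat \<Rightarrow> rat \<times> rat \<times> rat \<times> rat \<Rightarrow> rat" where
  "quaternion_norm a b = (\<lambda>(t, x, y, z). t\<^sup>2 - a * x\<^sup>2 - b * y\<^sup>2 + a * b * z\<^sup>2)"

text \<open>
  Otherwise the reduced characteristic polynomial $X^2 - 2tX + n$ would, after the substitution
  $X = 2tY$, have a root in $\mathbf{Q}_p$, and subtracting that root would give a zero divisor.
\<close>

lemma padic_division_trace_integral:
  assumes prime_p: "Factorial_Ring.prime p"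
    and skew: "skew_field (hilbert_algebra (padic_field p) (padic_of_rat p a) (padic_of_rat p b))"
    and norm: "padic_abs p (quaternion_norm a b (t, x, y, z)) \<le> 1"
  shows "padic_abs p (2 * t) \<le> 1"
proof (rule ccontr)
  assume "\<not> padic_abs p (2 * t) \<le> 1"
  then have gt: "padic_abs p (2 * t) > 1" by simp
  then have "t \<noteq> 0" by auto
  define n where "n = quaternion_norm a b (t, x, y, z)"
  \<comment> \<open>The substitution X = 2tY turns X^2 - 2tX + n into (2t)^2 (Y^2 - Y + c). Since
    |n| <= 1 < |2t|, this \<open>c\<close> is small.\<close>
  define c where "c = n / (2 * t)\<^sup>2"
  have n: "n = c * (2 * t)\<^sup>2" using \<open>t \<noteq> 0\<close> by (simp add: c_def)
  have "padic_abs p n = padic_abs p c * padic_abs p (2 * t) ^ 2"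
    unfolding n by (simp only: padic_abs_mult[OF prime_p] padic_abs_power[OF prime_p])
  moreover have "padic_abs p (2 * t) ^ 2 > 1" using gt by (simp add: one_less_power)
  ultimately have c: "padic_abs p c < 1"
    using norm unfolding n_def[symmetric]
    by (smt (verit) mult_le_cancel_right1 padic_abs_nonneg mult_less_cancel_right2)
  let ?r = "quadratic_root_approx c"
  let ?H = "hilbert_algebra (padic_field p) (padic_of_rat p a) (padic_of_rat p b)"
  let ?\<pi> = "padic_class p"
  \<comment> \<open>Represents t - alpha for the root alpha = 2t y, where y is the limit of the
    approximations.\<close>
  define s where "s = (\<lambda>n. t - 2 * t * ?r n)"
  note ca = padic_cauchy_const[OF prime_p] padic_cauchy_mult[OF prime_p]
    padic_cauchy_add[OF prime_p] padic_cauchy_uminus[OF prime_p]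
  have cd: "padic_cauchy p (\<lambda>n. f n - g n)" if "padic_cauchy p f" "padic_cauchy p g" for f g
    using ca(3)[OF that(1) ca(4)[OF that(2)]] by simp
  have s: "padic_cauchy p s"
    unfolding s_def by (intro cd ca quadratic_root_approx_cauchy[OF prime_p c])
  \<comment> \<open>These are v - alpha and its conjugate, for v = t + x i + y j + z k.\<close>
  define w w' where "w = (?\<pi> s, ?\<pi> (\<lambda>n. x), ?\<pi> (\<lambda>n. y), ?\<pi> (\<lambda>n. z))"
    and "w' = (?\<pi> s, ?\<pi> (\<lambda>n. - x), ?\<pi> (\<lambda>n. - y), ?\<pi> (\<lambda>n. - z))"
  have carr: "w \<in> carrier ?H" "w' \<in> carrier ?H"
    using s by (auto simp: w_def w'_def hilbert_algebra_def ca padic_class_closed[OF prime_p])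
  \<comment> \<open>The scalar part of the product is the reduced characteristic polynomial of v at
    the approximate root, that is, (2t)^2 times the residue of Y^2 - Y + c.\<close>
  have "(\<lambda>k. s k * s k + a * (x * - x) + b * (y * - y) - a * b * (z * - z))
      = (\<lambda>k. ((?r k)\<^sup>2 - ?r k + c) * (2 * t)\<^sup>2)"
  proof
    fix k
    have "s k * s k + a * (x * - x) + b * (y * - y) - a * b * (z * - z)
        = n + (2 * t)\<^sup>2 * ((?r k)\<^sup>2 - ?r k)"
      by (simp add: n_def quaternion_norm_def s_def power2_eq_square algebra_simps)
    then show "s k * s k + a * (x * - x) + b * (y * - y) - a * b * (z * - z)
        = ((?r k)\<^sup>2 - ?r k + c) * (2 * t)\<^sup>2"
      by (simp add: n algebra_simps)
  qed
  then have null: "padic_null p (\<lambda>k. s k * s k + a * (x * - x) + b * (y * - y) - a * b * (z * - z))"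
    using padic_null_mult[OF prime_p quadratic_root_approx_null[OF prime_p c] ca(1)] by simp
  have zero: "?\<pi> f = \<zero>\<^bsub>padic_field p\<^esub>" if "padic_null p f" for f
    using that padic_class_eq_zero_iff[OF prime_p] padic_null_imp_cauchy[OF prime_p] by simp
  have pr: "padic_of_rat p q = ?\<pi> (\<lambda>n. q)" for q
    by (simp add: padic_of_rat_def padic_class_def)
  note ops = padic_class_mult[OF prime_p] padic_class_add[OF prime_p] padic_class_diff[OF prime_p]
  have "w \<otimes>\<^bsub>?H\<^esub> w' =
    (?\<pi> (\<lambda>k. s k * s k + a * (x * - x) + b * (y * - y) - a * b * (z * - z)),
     ?\<pi> (\<lambda>k. s k * - x + x * s k + b * (z * - y) - b * (y * - z)),
     ?\<pi> (\<lambda>k. s k * - y + y * s k + a * (x * - z) - a * (z * - x)),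
     ?\<pi> (\<lambda>k. s k * - z + z * s k + x * - y - y * - x))"
    unfolding hilbert_algebra_def w_def w'_def pr
    by (simp only: monoid.simps prod.case ops ca cd s)
  also have "\<dots> = \<zero>\<^bsub>?H\<^esub>"
    unfolding zero[OF null]
    by (simp add: hilbert_algebra_def zero padic_null_const_iff[OF prime_p] mult.commute)
  finally consider "w = \<zero>\<^bsub>?H\<^esub>" | "w' = \<zero>\<^bsub>?H\<^esub>"
    using skew_field_no_zero_divisors[OF skew carr] by blast
  then have "x = 0 \<and> y = 0 \<and> z = 0"
    by cases (simp_all add: w_def w'_def hilbert_algebra_def padic_class_eq_zero_iff[OF prime_p] ca
        padic_null_const_iff[OF prime_p])
  \<comment> \<open>Now v is the rational \<open>t\<close>, and a vanishing factor is no
    contradiction. Instead the norm bounds \<open>t\<close> itself, and |2| <= 1 carries the bound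
    over to the trace.\<close>
  then have "n = t\<^sup>2" by (simp add: n_def quaternion_norm_def)
  then have "padic_abs p t ^ 2 \<le> 1" using norm by (simp add: n_def padic_abs_power[OF prime_p])
  then have "padic_abs p t \<le> 1" by (simp add: power_le_one_iff)
  then have "padic_abs p (of_int 2) * padic_abs p t \<le> 1"
    using padic_abs_of_int_le_1[OF prime_p, of 2] by (intro mult_le_one) auto
  then show False using gt by (simp add: padic_abs_mult[OF prime_p])
qed

section \<open>Reduced norms and integers in coordinates\<close>

lemma rat_field_simps:
  "carrier rat_field = UNIV" "u \<otimes>\<^bsub>rat_field\<^esub> v = u * v" "u \<oplus>\<^bsub>rat_field\<^esub> v = u + v"
  "\<one>\<^bsub>rat_field\<^esub> = 1" "\<zero>\<^bsub>rat_field\<^esub> = 0"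
  by (simp_all add: ring_of_type_algebra_def)

lemma rat_field_minus: "u \<ominus>\<^bsub>rat_field\<^esub> v = u - v"
proof -
  interpret ring rat_field by (rule ring_from_type_algebra)
  have "\<ominus>\<^bsub>rat_field\<^esub> v = - v" by (rule minus_equality) (simp_all add: rat_field_simps)
  then show ?thesis by (simp add: a_minus_def rat_field_simps)
qed

lemma hilbert_rat_simps:
  "carrier (hilbert_algebra rat_field a b) = UNIV"
  "(t, x, y, z) \<otimes>\<^bsub>hilbert_algebra rat_field a b\<^esub> (t', x', y', z') =
     (t * t' + a * (x * x') + b * (y * y') - a * b * (z * z'),
      t * x' + x * t' + b * (z * y') - b * (y * z'),
      t * y' + y * t' + a * (x * z') - a * (z * x'),
      t * z' + z * t' + x * y' - y * x')"
  "(t, x, y, z) \<oplus>\<^bsub>hilbert_algebra rat_field a b\<^esub> (t', x', y', z') = (t + t', x + x', y + y', z + z')"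
  "\<one>\<^bsub>hilbert_algebra rat_field a b\<^esub> = (1, 0, 0, 0)"
  "\<zero>\<^bsub>hilbert_algebra rat_field a b\<^esub> = (0, 0, 0, 0)"
  "c \<odot>\<^bsub>hilbert_algebra rat_field a b\<^esub> (t, x, y, z) = (c * t, c * x, c * y, c * z)"
  by (simp_all add: hilbert_algebra_def rat_field_simps rat_field_minus)

text \<open>For rational quaternions: the minimal polynomial X - t asks for \<open>t\<close>
  integral, the trace-norm criterion for 2t and t^2. The square of 2t is 4t^2, so 2t is
  even.\<close>

lemma half_Ints_if_square_Ints:
  assumes "2 * t \<in> \<int>" "t\<^sup>2 \<in> \<int>"
  shows "(t::rat) \<in> \<int>"
proof -
  obtain k where k: "2 * t = of_int k" using assms(1) by (auto elim: Ints_cases)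
  obtain m where m: "t\<^sup>2 = of_int m" using assms(2) by (auto elim: Ints_cases)
  have "(2 * t)\<^sup>2 = 4 * t\<^sup>2" by (simp add: power_mult_distrib)
  then have "of_int (k\<^sup>2) = (of_int (4 * m) :: rat)" unfolding k m by simp
  then have "k\<^sup>2 = 4 * m" by (simp only: of_int_eq_iff)
  then have "even (k\<^sup>2)" by simp
  then have "even k" by simp
  then obtain l where "k = 2 * l" by blast
  then have "t = of_int l" using k by simp
  then show ?thesis by simp
qed

lemma is_min_poly_degree_le:
  assumes "is_min_poly A x p" "is_min_poly A x q"
  shows "degree p \<le> degree q"
proof -
  have "lead_coeff q = 1" "algebra_poly A q x = \<zero>\<^bsub>A\<^esub>" using assms(2) by (simp_all add: is_min_poly_def)
  moreover from this have "q \<noteq> 0" by auto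
  ultimately show ?thesis using assms(1) by (simp add: is_min_poly_def)
qed

section \<open>Transport along an isomorphism with a Hilbert symbol algebra\<close>

context
  fixes A :: "(rat, 'a, 'm) module_scheme" and a b :: rat
    and h :: "rat \<times> rat \<times> rat \<times> rat \<Rightarrow> 'a"
  assumes alg: "assoc_algebra rat_field A"
    and iso: "h \<in> algebra_iso rat_field (hilbert_algebra rat_field a b) A"
begin

lemma module_A: "module rat_field A"
  using alg by (simp add: assoc_algebra_def)

lemma ring_A: "ring A"
  using alg by (simp add: assoc_algebra_def)

lemma ring_iso_h: "h \<in> ring_iso (hilbert_algebra rat_field a b) A"
  using iso by (simp add: algebra_iso_def)

lemma bij_h: "bij_betw h UNIV (carrier A)"
  using ring_iso_memE(5)[OF ring_iso_h] by (simp add: hilbert_rat_simps)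

lemma inj_h: "inj h"
  using bij_h by (rule bij_betw_imp_inj_on)

lemma carrier_eq_range: "carrier A = range h"
  using bij_h by (simp add: bij_betw_def)

lemma h_mult:
  "h (t, x, y, z) \<otimes>\<^bsub>A\<^esub> h (t', x', y', z') =
   h (t * t' + a * (x * x') + b * (y * y') - a * b * (z * z'),
      t * x' + x * t' + b * (z * y') - b * (y * z'),
      t * y' + y * t' + a * (x * z') - a * (z * x'),
      t * z' + z * t' + x * y' - y * x')"
  using ring_iso_memE(2)[OF ring_iso_h, of "(t, x, y, z)" "(t', x', y', z')"]
  by (simp add: hilbert_rat_simps)

lemma h_add: "h (t, x, y, z) \<oplus>\<^bsub>A\<^esub> h (t', x', y', z') = h (t + t', x + x', y + y', z + z')"
  using ring_iso_memE(3)[OF ring_iso_h, of "(t, x, y, z)" "(t', x', y', z')"]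
  by (simp add: hilbert_rat_simps)

lemma h_one: "\<one>\<^bsub>A\<^esub> = h (1, 0, 0, 0)"
  using ring_iso_memE(4)[OF ring_iso_h] by (simp add: hilbert_rat_simps)

lemma h_smult: "c \<odot>\<^bsub>A\<^esub> h (t, x, y, z) = h (c * t, c * x, c * y, c * z)"
proof -
  have "h (c \<odot>\<^bsub>hilbert_algebra rat_field a b\<^esub> v) = c \<odot>\<^bsub>A\<^esub> h v" for v
    using iso by (simp add: algebra_iso_def hilbert_rat_simps(1) rat_field_simps del: split_paired_All)
  from this[of "(t, x, y, z)"] show ?thesis by (simp add: hilbert_rat_simps)
qed

lemma h_closed: "h v \<in> carrier A"
  by (simp add: carrier_eq_range)

lemma h_zero: "\<zero>\<^bsub>A\<^esub> = h (0, 0, 0, 0)"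
proof -
  interpret ring A by (rule ring_A)
  have "h (0, 0, 0, 0) \<oplus>\<^bsub>A\<^esub> h (0, 0, 0, 0) = h (0, 0, 0, 0)" by (simp add: h_add)
  then show ?thesis using h_closed by (metis add.r_cancel_one')
qed

lemma h_eq_iff: "h u = h v \<longleftrightarrow> u = v"
  using inj_h by (simp add: inj_eq)

lemma ball_carrier_iff: "(\<forall>w\<in>carrier A. P w) \<longleftrightarrow> (\<forall>t x y z. P (h (t, x, y, z)))"
  by (simp add: carrier_eq_range)

text \<open>Existence half of the well-definedness of \<open>reduced_norm\<close>: quaternion
  conjugation carried over by \<open>h\<close>, with \<open>inv_into\<close> reading off the
  coordinates.\<close>

lemma standard_involution_conj:
  "standard_involution A (\<lambda>w. case inv_into UNIV h w of (t, x, y, z) \<Rightarrow> h (t, - x, - y, - z))"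
    (is "standard_involution A ?s")
proof -
  have s: "?s (h (t, x, y, z)) = h (t, - x, - y, - z)" for t x y z
    by (simp add: inv_f_f[OF inj_h])
  have "\<exists>c. h (t, x, y, z) \<otimes>\<^bsub>A\<^esub> h (t, - x, - y, - z) = c \<odot>\<^bsub>A\<^esub> \<one>\<^bsub>A\<^esub>" for t x y z
    by (rule exI[of _ "quaternion_norm a b (t, x, y, z)"])
      (simp add: h_mult h_one h_smult h_eq_iff quaternion_norm_def power2_eq_square)
  moreover have "?s \<in> carrier A \<rightarrow> carrier A"
    by (auto simp: h_closed split: prod.split)
  ultimately show ?thesis
    unfolding standard_involution_def ball_carrier_iff
    by (simp add: s h_mult h_add h_one h_smult h_eq_iff algebra_simps)
qed

text \<open>Uniqueness half. Both v s(v) and (v + 1) s(v + 1) are scalars; their difference makes v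
  + s(v) a scalar, which determines the imaginary part of s(v), and then v s(v) determines its real
  part.\<close>

lemma standard_involution_norm:
  assumes s: "standard_involution A s"
    and c: "h (t, x, y, z) \<otimes>\<^bsub>A\<^esub> s (h (t, x, y, z)) = c \<odot>\<^bsub>A\<^esub> \<one>\<^bsub>A\<^esub>"
  shows "c = quaternion_norm a b (t, x, y, z)"
proof -
  let ?v = "h (t, x, y, z)"
  have "s ?v \<in> carrier A" using s h_closed by (auto simp: standard_involution_def)
  then obtain t' x' y' z' where sv: "s ?v = h (t', x', y', z')"
    unfolding carrier_eq_range by auto
  show ?thesis
  proof (cases "x = 0 \<and> y = 0 \<and> z = 0")
    \<comment> \<open>For scalar v the imaginary equations leave the real part of s(v) open;
      linearity and s(1) = 1 settle it.\<close>
    case True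
    have "s (t \<odot>\<^bsub>A\<^esub> \<one>\<^bsub>A\<^esub>) = t \<odot>\<^bsub>A\<^esub> \<one>\<^bsub>A\<^esub>"
      using s h_closed unfolding standard_involution_def h_one by metis
    then have "s ?v = ?v" using True by (simp add: h_one h_smult)
    then show ?thesis
      using c True by (simp add: h_mult h_one h_smult h_eq_iff quaternion_norm_def power2_eq_square)
  next
    case False
    have "s (?v \<oplus>\<^bsub>A\<^esub> \<one>\<^bsub>A\<^esub>) = s ?v \<oplus>\<^bsub>A\<^esub> \<one>\<^bsub>A\<^esub>"
      using s h_closed unfolding standard_involution_def h_one by metis
    moreover have "\<exists>d. (?v \<oplus>\<^bsub>A\<^esub> \<one>\<^bsub>A\<^esub>) \<otimes>\<^bsub>A\<^esub> s (?v \<oplus>\<^bsub>A\<^esub> \<one>\<^bsub>A\<^esub>) = d \<odot>\<^bsub>A\<^esub> \<one>\<^bsub>A\<^esub>"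
      using s h_closed unfolding standard_involution_def h_one h_add by blast
    ultimately obtain d where d: "(?v \<oplus>\<^bsub>A\<^esub> \<one>\<^bsub>A\<^esub>) \<otimes>\<^bsub>A\<^esub> (s ?v \<oplus>\<^bsub>A\<^esub> \<one>\<^bsub>A\<^esub>) = d \<odot>\<^bsub>A\<^esub> \<one>\<^bsub>A\<^esub>"
      by auto
    have C: "t * t' + a * (x * x') + b * (y * y') - a * b * (z * z') = c"
      "t * x' + x * t' + b * (z * y') - b * (y * z') = 0"
      "t * y' + y * t' + a * (x * z') - a * (z * x') = 0"
      "t * z' + z * t' + x * y' - y * x' = 0"
      using c by (simp_all add: sv h_mult h_one h_smult h_eq_iff)
    have D: "(t + 1) * x' + x * (t' + 1) + b * (z * y') - b * (y * z') = 0"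
      "(t + 1) * y' + y * (t' + 1) + a * (x * z') - a * (z * x') = 0"
      "(t + 1) * z' + z * (t' + 1) + x * y' - y * x' = 0"
      using d by (simp_all add: sv h_mult h_add h_one h_smult h_eq_iff)
    \<comment> \<open>Subtracting each equation of \<open>C\<close> from its counterpart in
      \<open>D\<close> leaves x' + x = 0 and its analogues.\<close>
    have xyz: "x' = - x" "y' = - y" "z' = - z"
      using C D by (simp_all add: algebra_simps)
    have "x * (t' - t) = 0" "y * (t' - t) = 0" "z * (t' - t) = 0"
      using C(2-4) by (simp_all add: xyz algebra_simps)
    then have "t' = t" using False by auto
    then show ?thesis using C(1) by (simp add: xyz quaternion_norm_def power2_eq_square)
  qed
qed

lemma reduced_norm_h: "reduced_norm A (h v) = quaternion_norm a b v"
proof -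
  obtain t x y z where v: "v = (t, x, y, z)" by (cases v)
  let ?s = "\<lambda>w. case inv_into UNIV h w of (t, x, y, z) \<Rightarrow> h (t, - x, - y, - z)"
  have "h v \<otimes>\<^bsub>A\<^esub> ?s (h v) = quaternion_norm a b v \<odot>\<^bsub>A\<^esub> \<one>\<^bsub>A\<^esub>"
    by (simp add: v inv_f_f[OF inj_h] h_mult h_one h_smult h_eq_iff quaternion_norm_def power2_eq_square)
  then show ?thesis
    unfolding reduced_norm_def using standard_involution_conj standard_involution_norm
    unfolding v by (intro the_equality) blast+
qed

text \<open>Rests on v^2 = 2t v - N, with N the norm of v. Degree 2 suffices, because minimal
  polynomials here have degree 1 or 2.\<close>

lemma algebra_poly_h:
  assumes "degree p \<le> 2"
  shows "algebra_poly A p (h (t, x, y, z)) =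
    h (coeff p 0 + coeff p 1 * t + coeff p 2 * (2 * t\<^sup>2 - quaternion_norm a b (t, x, y, z)),
       (coeff p 1 + 2 * coeff p 2 * t) * x,
       (coeff p 1 + 2 * coeff p 2 * t) * y,
       (coeff p 1 + 2 * coeff p 2 * t) * z)"
proof -
  interpret R: ring A by (rule ring_A)
  interpret M: module rat_field A by (rule module_A)
  let ?v = "h (t, x, y, z)"
  define f where "f i = coeff p i \<odot>\<^bsub>A\<^esub> (?v [^]\<^bsub>A\<^esub> i)" for i :: nat
  have f_closed: "f i \<in> carrier A" for i
    by (simp add: f_def rat_field_simps h_closed)
  have "?v [^]\<^bsub>A\<^esub> (0::nat) = h (1, 0, 0, 0)" "?v [^]\<^bsub>A\<^esub> (1::nat) = ?v"
    "?v [^]\<^bsub>A\<^esub> (2::nat) = h (2 * t\<^sup>2 - quaternion_norm a b (t, x, y, z), 2 * t * x, 2 * t * y, 2 * t * z)"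
    using h_closed
    by (simp_all add: h_one h_mult h_eq_iff quaternion_norm_def numeral_2_eq_2 algebra_simps)
  then have f: "f 0 = h (coeff p 0, 0, 0, 0)"
    "f 1 = h (coeff p 1 * t, coeff p 1 * x, coeff p 1 * y, coeff p 1 * z)"
    "f 2 = h (coeff p 2 * (2 * t\<^sup>2 - quaternion_norm a b (t, x, y, z)),
        coeff p 2 * (2 * t * x), coeff p 2 * (2 * t * y), coeff p 2 * (2 * t * z))"
    by (simp_all only: f_def h_smult mult_1_right mult_zero_right)
  \<comment> \<open>Padding with zero coefficients up to degree 2 gives the sum three terms whatever
    the degree of \<open>p\<close>.\<close>
  have "algebra_poly A p ?v = (\<Oplus>\<^bsub>A\<^esub>i\<in>{..2}. f i)"
    unfolding algebra_poly_def f_def[symmetric]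
  proof (rule R.add.finprod_mono_neutral_cong_left)
    show "f i = \<zero>\<^bsub>A\<^esub>" if "i \<in> {..2} - {..degree p}" for i
    proof -
      have "?v [^]\<^bsub>A\<^esub> i \<in> carrier A" using h_closed by simp
      then show ?thesis using that M.smult_l_null by (simp add: f_def coeff_eq_0 rat_field_simps)
    qed
  qed (use assms f_closed in auto)
  also have "\<dots> = f 2 \<oplus>\<^bsub>A\<^esub> (f 1 \<oplus>\<^bsub>A\<^esub> f 0)"
    by (simp add: numeral_2_eq_2 Pi_iff f_closed)
  finally show ?thesis by (simp only: f h_add h_eq_iff) (simp add: algebra_simps)
qed

text \<open>Off the rationals the minimal polynomial is X^2 - 2tX + N. On them it is X - t, and
  \<open>half_Ints_if_square_Ints\<close> reconciles this with the same criterion.\<close>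

lemma is_integer_h:
  "is_integer A (h (t, x, y, z)) \<longleftrightarrow> 2 * t \<in> \<int> \<and> quaternion_norm a b (t, x, y, z) \<in> \<int>"
proof -
  let ?v = "h (t, x, y, z)" and ?N = "quaternion_norm a b (t, x, y, z)"
  show ?thesis
  proof (cases "x = 0 \<and> y = 0 \<and> z = 0")
    case True
    have ann: "algebra_poly A p ?v = \<zero>\<^bsub>A\<^esub> \<longleftrightarrow> coeff p 0 + coeff p 1 * t = 0" if "degree p \<le> 1" for p
      using that True by (simp add: algebra_poly_h h_zero h_eq_iff coeff_eq_0)
    have deg: "1 \<le> degree q" if "q \<noteq> 0" "algebra_poly A q ?v = \<zero>\<^bsub>A\<^esub>" for q
    proof (rule ccontr)
      assume "\<not> 1 \<le> degree q"
      then have "degree q = 0" by simp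
      then have "lead_coeff q = 0" using that ann[of q] by (simp add: coeff_eq_0)
      then show False using that by simp
    qed
    have min: "is_min_poly A ?v [:- t, 1:]"
      using deg by (simp add: is_min_poly_def ann)
    \<comment> \<open>\<open>is_integer\<close> only asks for some minimal polynomial, so
      integrality of specific coefficients requires uniqueness.\<close>
    have uniq: "p = [:- t, 1:]" if "is_min_poly A ?v p" for p
    proof -
      have "p \<noteq> 0" using that by (auto simp: is_min_poly_def)
      moreover have p: "lead_coeff p = 1" "algebra_poly A p ?v = \<zero>\<^bsub>A\<^esub>" "degree p \<le> degree [:- t, 1:]"
        using that is_min_poly_degree_le[OF that min] by (simp_all add: is_min_poly_def)
      ultimately have d: "degree p = 1" using deg[of p] by simp
      then have "coeff p 1 = 1" "coeff p 0 = - t" using p ann[of p] by auto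
      then show ?thesis
        using d by (intro poly_eqI) (auto simp: coeff_pCons coeff_eq_0 split: nat.split)
    qed
    have "is_integer A ?v \<longleftrightarrow> (\<forall>i. coeff [:- t, 1:] i \<in> \<int>)"
      using min uniq h_closed unfolding is_integer_def by metis
    also have "\<dots> \<longleftrightarrow> t \<in> \<int>"
      by (auto simp: coeff_pCons split: nat.splits)
    also have "\<dots> \<longleftrightarrow> 2 * t \<in> \<int> \<and> ?N \<in> \<int>"
      using True half_Ints_if_square_Ints[of t] by (auto simp: quaternion_norm_def)
    finally show ?thesis .
  next
    case False
    \<comment> \<open>A nonzero imaginary coordinate forces the linear coefficient; substituting it
      into the scalar part leaves exactly the multiples of X^2 - 2tX + N.\<close>
    have ann: "algebra_poly A p ?v = \<zero>\<^bsub>A\<^esub> \<longleftrightarrow>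
        coeff p 1 = - 2 * coeff p 2 * t \<and> coeff p 0 = coeff p 2 * ?N" if "degree p \<le> 2" for p
    proof -
      have "algebra_poly A p ?v = \<zero>\<^bsub>A\<^esub> \<longleftrightarrow> coeff p 1 + 2 * coeff p 2 * t = 0 \<and>
          coeff p 0 + coeff p 1 * t + coeff p 2 * (2 * t\<^sup>2 - ?N) = 0"
        using that False by (auto simp: algebra_poly_h h_zero h_eq_iff)
      also have "\<dots> \<longleftrightarrow> coeff p 1 = - 2 * coeff p 2 * t \<and>
          coeff p 0 + coeff p 1 * t + coeff p 2 * (2 * t\<^sup>2 - ?N) = 0"
        by (auto simp: eq_neg_iff_add_eq_0)
      also have "\<dots> \<longleftrightarrow> coeff p 1 = - 2 * coeff p 2 * t \<and> coeff p 0 = coeff p 2 * ?N"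
        by (auto simp: power2_eq_square algebra_simps)
      finally show ?thesis .
    qed
    have deg: "2 \<le> degree q" if "q \<noteq> 0" "algebra_poly A q ?v = \<zero>\<^bsub>A\<^esub>" for q
    proof (rule ccontr)
      assume "\<not> 2 \<le> degree q"
      then have d: "degree q \<le> 1" by simp
      then have "coeff q 2 = 0" by (simp add: coeff_eq_0)
      then have c: "coeff q 1 = 0" "coeff q 0 = 0" using ann[of q] that d by auto
      have "degree q = 0 \<or> degree q = 1" using d by linarith
      then have "lead_coeff q = 0" by (elim disjE) (simp_all only: c)
      then show False using that by simp
    qed
    have min: "is_min_poly A ?v [:?N, - 2 * t, 1:]"
      using deg by (simp add: is_min_poly_def ann numeral_2_eq_2)
    have uniq: "p = [:?N, - 2 * t, 1:]" if "is_min_poly A ?v p" for p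
    proof -
      have "p \<noteq> 0" using that by (auto simp: is_min_poly_def)
      moreover have p: "lead_coeff p = 1" "algebra_poly A p ?v = \<zero>\<^bsub>A\<^esub>"
          "degree p \<le> degree [:?N, - 2 * t, 1:]"
        using that is_min_poly_degree_le[OF that min] by (simp_all add: is_min_poly_def)
      ultimately have d: "degree p = 2" using deg[of p] by simp
      then have "coeff p 2 = 1" "coeff p 1 = - 2 * t" "coeff p 0 = ?N" using p ann[of p] by auto
      then show ?thesis
        using d by (intro poly_eqI) (auto simp: coeff_pCons coeff_eq_0 numeral_2_eq_2 split: nat.split)
    qed
    have "is_integer A ?v \<longleftrightarrow> (\<forall>i. coeff [:?N, - 2 * t, 1:] i \<in> \<int>)"
      using min uniq h_closed unfolding is_integer_def by metis
    also have "\<dots> \<longleftrightarrow> 2 * t \<in> \<int> \<and> ?N \<in> \<int>"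
    proof
      assume *: "\<forall>i. coeff [:?N, - 2 * t, 1:] i \<in> \<int>"
      have "?N \<in> \<int>" using *[rule_format, of 0] by simp
      moreover have "- 2 * t \<in> \<int>" using *[rule_format, of 1] by simp
      then have "- (- 2 * t) \<in> \<int>" by (rule Ints_minus)
      ultimately show "2 * t \<in> \<int> \<and> ?N \<in> \<int>" by simp
    next
      assume "2 * t \<in> \<int> \<and> ?N \<in> \<int>"
      then show "\<forall>i. coeff [:?N, - 2 * t, 1:] i \<in> \<int>"
        by (auto simp: coeff_pCons split: nat.splits)
    qed
    finally show ?thesis .
  qed
qed

end

section \<open>Scaling by r and the equivalence\<close>

lemma quaternion_norm_scale:
  "quaternion_norm a b (c * t, c * x, c * y, c * z) = c\<^sup>2 * quaternion_norm a b (t, x, y, z)"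
  by (simp add: quaternion_norm_def power2_eq_square algebra_simps)

theorem theorem5p6:
  fixes A :: "(rat, 'a, 'm) module_scheme" and r :: nat
  assumes "rat_quaternion_algebra A"
    and "definite A"
    and "Factorial_Ring.prime r"
    and "ramified_at_prime r A"
  shows "\<forall>m::nat. m > 0 \<longrightarrow> (outlier A m \<longleftrightarrow> outlier A (m * r\<^sup>2))"
proof (intro allI impI)
  fix m :: nat assume "m > 0"
  note prime_r = assms(3)
  have r0: "r > 0" using prime_r by (rule prime_gt_0_nat)
  have alg: "assoc_algebra rat_field A" using assms(1) by (simp add: rat_quaternion_algebra_def)
  \<comment> \<open>The pair witnessing ramification also provides the rational coordinates, so
    norms and the completion are expressed in the same \<open>a\<close>, \<open>b\<close>.\<close>
  obtain a b where "has_hilbert_symbol A a b"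
    and skew: "skew_field (hilbert_algebra (padic_field r) (padic_of_rat r a) (padic_of_rat r b))"
    using assms(4) by (auto simp: ramified_at_prime_def ramified_in_def)
  then obtain h where iso: "h \<in> algebra_iso rat_field (hilbert_algebra rat_field a b) A"
    by (auto simp: has_hilbert_symbol_def)
  note carr = carrier_eq_range[OF alg iso] and nrd = reduced_norm_h[OF alg iso]
    and int = is_integer_h[OF alg iso]
  let ?N = "quaternion_norm a b" and ?r = "of_nat r :: rat"
  \<comment> \<open>An element of norm \<open>k\<close> has integral norm already, so being an
    integer reduces to integrality of the trace 2t.\<close>
  have outlier_iff: "outlier A k \<longleftrightarrow> k > 0 \<and> (\<exists>t x y z. ?N (t, x, y, z) = of_nat k)
      \<and> \<not> (\<exists>t x y z. 2 * t \<in> \<int> \<and> ?N (t, x, y, z) = of_nat k)" for k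
  proof -
    have "(\<exists>w. is_integer A w \<and> reduced_norm A w = of_nat k) \<longleftrightarrow>
        (\<exists>w\<in>carrier A. is_integer A w \<and> reduced_norm A w = of_nat k)"
      by (auto simp: is_integer_def)
    also have "\<dots> \<longleftrightarrow> (\<exists>t x y z. 2 * t \<in> \<int> \<and> ?N (t, x, y, z) = of_nat k)"
      unfolding carr by (simp add: nrd int) (metis Ints_of_nat)
    finally show ?thesis unfolding outlier_def carr by (simp add: nrd)
  qed
  have up: "?N (?r * t, ?r * x, ?r * y, ?r * z) = of_nat (m * r\<^sup>2)"
    if "?N (t, x, y, z) = of_nat m" for t x y z
    using that by (simp add: quaternion_norm_scale)
  have down: "?N (inverse ?r * t, inverse ?r * x, inverse ?r * y, inverse ?r * z) = of_nat m"
    if "?N (t, x, y, z) = of_nat (m * r\<^sup>2)" for t x y z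
    unfolding quaternion_norm_scale that using r0 by (simp add: field_simps)
  have up_int: "2 * (?r * t) \<in> \<int>" if "2 * t \<in> \<int>" for t :: rat
  proof -
    have "2 * (?r * t) = ?r * (2 * t)" by simp
    also have "\<dots> \<in> \<int>" using Ints_of_nat that by (rule Ints_mult)
    finally show ?thesis .
  qed
  \<comment> \<open>The trace is an integer before division by \<open>r\<close>, so integrality can
    fail only at \<open>r\<close>, where the division algebra supplies the bound.\<close>
  have down_int: "2 * (inverse ?r * t) \<in> \<int>"
    if t: "2 * t \<in> \<int>" and N: "?N (t, x, y, z) = of_nat (m * r\<^sup>2)" for t x y z
  proof -
    obtain k where k: "2 * t = of_int k" using t by (auto elim: Ints_cases)
    have "padic_abs r (?N (inverse ?r * t, inverse ?r * x, inverse ?r * y, inverse ?r * z)) \<le> 1"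
      using padic_abs_of_int_le_1[OF prime_r, of "int m"] by (simp add: down[OF N])
    then have le: "padic_abs r (2 * (inverse ?r * t)) \<le> 1"
      by (rule padic_division_trace_integral[OF prime_r skew])
    have "int r dvd k"
    proof (rule ccontr)
      assume "\<not> int r dvd k"
      \<comment> \<open>An integer prime to \<open>r\<close> has absolute value 1, but
        \<open>k\<close> is \<open>r\<close> times a trace of absolute value at most 1, hence has
        absolute value at most 1/r.\<close>
      then have "1 = padic_abs r (of_int k)" by (simp add: padic_abs_unit[OF prime_r])
      also have "of_int k = ?r * (2 * (inverse ?r * t))" using r0 by (simp add: k[symmetric])
      also have "padic_abs r \<dots> = 1 / real r * padic_abs r (2 * (inverse ?r * t))"
        unfolding padic_abs_mult[OF prime_r, of ?r] padic_abs_p[OF prime_r] ..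
      also have "\<dots> \<le> 1 / real r * 1" using le by (intro mult_left_mono) auto
      also have "\<dots> < 1" using prime_gt_1_nat[OF prime_r] by simp
      finally show False by simp
    qed
    then obtain l where "k = int r * l" by blast
    then have "2 * (inverse ?r * t) = of_int l" using k r0 by (simp add: field_simps)
    then show ?thesis by simp
  qed
  show "outlier A m \<longleftrightarrow> outlier A (m * r\<^sup>2)"
  proof -
    have "(\<exists>t x y z. ?N (t, x, y, z) = of_nat m) \<longleftrightarrow> (\<exists>t x y z. ?N (t, x, y, z) = of_nat (m * r\<^sup>2))"
      using up down by blast
    moreover have "(\<exists>t x y z. 2 * t \<in> \<int> \<and> ?N (t, x, y, z) = of_nat m)
        \<longleftrightarrow> (\<exists>t x y z. 2 * t \<in> \<int> \<and> ?N (t, x, y, z) = of_nat (m * r\<^sup>2))"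
      using up down up_int down_int by blast
    moreover have "m * r\<^sup>2 > 0" using \<open>m > 0\<close> r0 by simp
    ultimately show ?thesis unfolding outlier_iff using \<open>m > 0\<close> by simp
  qed
qed

end
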